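(* Let $A,B,C\in \mathbb{C}_{n,n}$ and $k\in\mathbb{N}$. Then $A$ is $(B,C)$-core-EP invertible with $k\in {\rm I}_{(B,C)}(A)$ if and only if $${\rm rk}((CA)^kB)={\rm rk}((CA)^kC)={\rm rk}((CA)^{k+1}B).$$
   Context: $\mathbb{N}=\{0,1,2,\dots\}$. $\mathbb{C}_{n,n}$ is the ring of all $n\times n$ complex matrices with involution $*$ the conjugate transpose; ${\rm rk}$ denotes rank. Write $S=\mathbb{C}_{n,n}$. $A$ is $(B,C)$-core-EP invertible if there exist $X\in S$ and $k\in\mathbb{N}$ such that $CAX(CA)^{k}C=(CA)^{k}C$, $XS=(CA)^{k}BS$ and $SX=S((CA)^{k}C)^{*}$; ${\rm I}_{(B,C)}(A)$ is the set of all $k\in\mathbb{N}$ for which such an $X$ exists. *)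

theory Defs
  imports "HOL-Analysis.Analysis"
begin

text \<open>The type \<open>complex ^ 'n ^ 'n\<close> plays the role of the ring \<open>S\<close> of all complex matrices of
  size \<open>CARD('n)\<close>. Its product is \<open>(**)\<close>; the overloaded \<open>(*)\<close> and \<open>(^)\<close> on this type are
  entrywise, which is why powers are defined separately here.\<close>

primrec mat_pow :: "'a::semiring_1 ^ 'n ^ 'n \<Rightarrow> nat \<Rightarrow> 'a ^ 'n ^ 'n" where
  "mat_pow M 0 = mat 1"
| "mat_pow M (Suc k) = M ** mat_pow M k"

definition conj_transpose :: "complex ^ 'n ^ 'm \<Rightarrow> complex ^ 'm ^ 'n" where
  "conj_transpose M = (\<chi> i j. cnj (M $ j $ i))"

definition right_ideal :: "complex ^ 'n ^ 'n \<Rightarrow> (complex ^ 'n ^ 'n) set" where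
  "right_ideal M = {M ** Y | Y. True}"

definition left_ideal :: "complex ^ 'n ^ 'n \<Rightarrow> (complex ^ 'n ^ 'n) set" where
  "left_ideal M = {Y ** M | Y. True}"

definition core_EP_inverse_at ::
  "complex ^ 'n ^ 'n \<Rightarrow> complex ^ 'n ^ 'n \<Rightarrow> complex ^ 'n ^ 'n \<Rightarrow> nat \<Rightarrow> complex ^ 'n ^ 'n \<Rightarrow> bool"
  where
  "core_EP_inverse_at B C A k X \<longleftrightarrow>
     C ** A ** X ** mat_pow (C ** A) k ** C = mat_pow (C ** A) k ** C \<and>
     right_ideal X = right_ideal (mat_pow (C ** A) k ** B) \<and>
     left_ideal X = left_ideal (conj_transpose (mat_pow (C ** A) k ** C))"

definition core_EP_invertible ::
  "complex ^ 'n ^ 'n \<Rightarrow> complex ^ 'n ^ 'n \<Rightarrow> complex ^ 'n ^ 'n \<Rightarrow> bool" where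
  "core_EP_invertible B C A \<longleftrightarrow> (\<exists>X k. core_EP_inverse_at B C A k X)"

definition core_EP_indices ::
  "complex ^ 'n ^ 'n \<Rightarrow> complex ^ 'n ^ 'n \<Rightarrow> complex ^ 'n ^ 'n \<Rightarrow> nat set" where
  "core_EP_indices B C A = {k. \<exists>X. core_EP_inverse_at B C A k X}"

end

theory Submission
  imports Defs
begin

text \<open>Put \<open>M = C A\<close>, \<open>P = M\<^sup>k B\<close> and \<open>Q = M\<^sup>k C\<close>, so that \<open>M P = Q A B\<close>. If \<open>X\<close> is an inverse, it has
  the rank of \<open>P\<close> and of \<open>Q\<close>, and \<open>Q = M X Q\<close> with \<open>X \<in> P S\<close> bounds the rank of \<open>Q\<close> by that of
  \<open>M P\<close>. Conversely, equality of the ranks of \<open>Q\<close> and \<open>M P\<close> yields \<open>U\<close> with \<open>Q = M P U\<close>; choosing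
  \<open>Z\<close> with \<open>Q = Q Z Q\<^sup>* Q\<close>, the matrix \<open>X = P U Z Q\<^sup>*\<close> satisfies \<open>M X Q = Q\<close>, so its rank is
  that of \<open>P\<close> and of \<open>Q\<^sup>*\<close>, and the inclusions \<open>X S \<subseteq> P S\<close> and \<open>S X \<subseteq> S Q\<^sup>*\<close> are equalities.\<close>

section \<open>Rank and factorization over a field\<close>

lemma row_matrix_mult:
  fixes A :: "'a::field ^ 'n ^ 'm" and B :: "'a ^ 'p ^ 'n"
  shows "row i (A ** B) = (\<Sum>j\<in>UNIV. (A $ i $ j) *s row j B)"
  by (simp add: vec_eq_iff row_def matrix_matrix_mult_def)

lemma row_matrix_mult_in_span:
  fixes A :: "'a::field ^ 'n ^ 'm" and B :: "'a ^ 'p ^ 'n"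
  shows "row i (A ** B) \<in> vec.span (rows B)"
  unfolding row_matrix_mult
  by (intro vec.span_sum vec.span_scale vec.span_base) (auto simp: rows_def)

lemma rows_mult_subset_span:
  fixes A :: "'a::field ^ 'n ^ 'm" and B :: "'a ^ 'p ^ 'n"
  shows "rows (A ** B) \<subseteq> vec.span (rows B)"
  using row_matrix_mult_in_span[of _ A B] by (auto simp: rows_def)

text \<open>The range of \<open>c \<mapsto> c v* D\<close> is a subspace that contains every row of
  \<open>D\<close>, hence contains their span.\<close>

lemma in_span_rows_imp_vector_matrix_mult:
  fixes D :: "'a::field ^ 'n ^ 'm"
  assumes "v \<in> vec.span (rows D)"
  shows "\<exists>c. v = c v* D"
proof -
  have "vec.span (rows D) \<subseteq> range (\<lambda>c. c v* D)"
  proof (rule vec.span_minimal)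
    show "rows D \<subseteq> range (\<lambda>c. c v* D)"
    proof
      fix r assume "r \<in> rows D"
      then obtain i where "r = row i D" by (auto simp: rows_def)
      \<comment> \<open>A standard basis vector on the left selects a single row.\<close>
      then have "r = axis i 1 v* D"
        by (simp add: vec_eq_iff row_def vector_matrix_mult_def axis_def if_distrib if_distribR cong: if_cong)
      then show "r \<in> range (\<lambda>c. c v* D)" by blast
    qed
    show "vec.subspace (range (\<lambda>c. c v* D))"
      unfolding vec.subspace_def
    proof (intro conjI ballI allI)
      have "0 = 0 v* D" by simp
      then show "0 \<in> range (\<lambda>c. c v* D)" by blast
    next
      fix x y assume "x \<in> range (\<lambda>c. c v* D)" "y \<in> range (\<lambda>c. c v* D)"
      then obtain c d where "x = c v* D" "y = d v* D" by blast
      then have "x + y = (c + d) v* D"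
        by (simp add: vec_eq_iff vector_matrix_mult_def algebra_simps sum.distrib)
      then show "x + y \<in> range (\<lambda>c. c v* D)" by blast
    next
      fix a x assume "x \<in> range (\<lambda>c. c v* D)"
      then obtain c where "x = c v* D" by blast
      then have "a *s x = (a *s c) v* D"
        by (simp add: vec_eq_iff vector_matrix_mult_def sum_distrib_left algebra_simps)
      then show "a *s x \<in> range (\<lambda>c. c v* D)" by blast
    qed
  qed
  with assms show ?thesis by blast
qed

lemma rows_in_span_imp_left_factor:
  fixes B :: "'a::field ^ 'n ^ 'p" and D :: "'a ^ 'n ^ 'm"
  assumes "rows B \<subseteq> vec.span (rows D)"
  shows "\<exists>Y. B = Y ** D"
proof -
  have "\<exists>c. row i B = c v* D" for i
    using assms by (intro in_span_rows_imp_vector_matrix_mult) (auto simp: rows_def)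
  then obtain c where c: "row i B = c i v* D" for i by metis
  have "B $ i $ j = (\<Sum>l\<in>UNIV. c i $ l * D $ l $ j)" for i j
    using arg_cong[OF c[of i], of "\<lambda>v. v $ j"]
    by (simp add: row_def vector_matrix_mult_def mult.commute)
  then have "B = (\<chi> i. c i) ** D"
    by (simp add: vec_eq_iff matrix_matrix_mult_def)
  then show ?thesis by blast
qed

lemma rank_mult_le_right:
  fixes A :: "'a::field ^ 'n ^ 'm" and B :: "'a ^ 'p ^ 'n"
  shows "rank (A ** B) \<le> rank B"
  unfolding row_rank_def_gen by (rule vec.dim_mono[OF rows_mult_subset_span])

text \<open>The row space of \<open>A ** B\<close> always lies in that of \<open>B\<close>; the rank
  bound makes the dimensions agree, so the two coincide and the rows of \<open>B\<close> are
  combinations of those of \<open>A ** B\<close>.\<close>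

lemma left_factor_of_rank_le:
  fixes A :: "'a::field ^ 'n ^ 'm" and B :: "'a ^ 'p ^ 'n"
  assumes "rank B \<le> rank (A ** B)"
  shows "\<exists>Y. B = Y ** (A ** B)"
proof (rule rows_in_span_imp_left_factor)
  have "vec.span (rows (A ** B)) = vec.span (rows B)"
  proof (rule vec.subspace_dim_equal)
    show "vec.span (rows (A ** B)) \<subseteq> vec.span (rows B)"
      by (intro vec.span_minimal rows_mult_subset_span vec.subspace_span)
    show "vec.dim (vec.span (rows B)) \<le> vec.dim (vec.span (rows (A ** B)))"
      using assms by (simp add: row_rank_def_gen)
  qed (rule vec.subspace_span)+
  then show "rows B \<subseteq> vec.span (rows (A ** B))"
    using vec.span_superset by blast
qed

text \<open>The expansion of the columns of \<open>A\<close> in a basis \<open>S\<close> of the column space, read by rows, exhibits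
  \<open>card S\<close> vectors spanning the row space.\<close>

lemma rank_le_rank_transpose:
  fixes A :: "'a::field ^ 'n ^ 'm"
  shows "rank A \<le> rank (transpose A)"
proof -
  obtain S where S: "S \<subseteq> columns A" "vec.independent S" "columns A \<subseteq> vec.span S"
      "card S = vec.dim (columns A)"
    using vec.basis_exists by blast
  have "finite S" using S(2) by (rule vec.finiteI_independent)
  have "\<exists>u. column j A = (\<Sum>b\<in>S. u b *s b)" for j
  proof -
    have "column j A \<in> vec.span S" using S(3) by (auto simp: columns_def)
    then show ?thesis using vec.span_finite[OF \<open>finite S\<close>] by auto
  qed
  then obtain u where u: "column j A = (\<Sum>b\<in>S. u j b *s b)" for j by metis
  define c where "c b = (\<chi> j. u j b)" for b
  have "row i A = (\<Sum>b\<in>S. (b $ i) *s c b)" for i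
  proof -
    have "A $ i $ j = (\<Sum>b\<in>S. b $ i * u j b)" for j
      using arg_cong[OF u[of j], of "\<lambda>v. v $ i"] by (simp add: column_def mult.commute)
    then show ?thesis by (simp add: vec_eq_iff row_def c_def)
  qed
  then have "rows A \<subseteq> vec.span (c ` S)"
    unfolding rows_def by (auto intro!: vec.span_sum vec.span_scale intro: vec.span_base)
  then have "vec.dim (rows A) \<le> card (c ` S)"
    using \<open>finite S\<close> by (intro vec.dim_le_card) auto
  also have "\<dots> \<le> card S" using \<open>finite S\<close> by (rule card_image_le)
  finally show ?thesis
    using S(4) by (simp add: row_rank_def_gen rows_transpose)
qed

lemma rank_transpose_field:
  fixes A :: "'a::field ^ 'n ^ 'm"
  shows "rank (transpose A) = rank A"
  using rank_le_rank_transpose[of A] rank_le_rank_transpose[of "transpose A"]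
  by (simp add: transpose_transpose)

lemma rank_mult_le_left:
  fixes A :: "'a::field ^ 'n ^ 'm" and B :: "'a ^ 'p ^ 'n"
  shows "rank (A ** B) \<le> rank A"
  using rank_mult_le_right[of "transpose B" "transpose A"]
  by (metis matrix_transpose_mul rank_transpose_field)

text \<open>Transposition preserves rank and turns this into
  \<open>left_factor_of_rank_le\<close>.\<close>

lemma right_factor_of_rank_le:
  fixes A :: "'a::field ^ 'n ^ 'm" and B :: "'a ^ 'p ^ 'n"
  assumes "rank A \<le> rank (A ** B)"
  shows "\<exists>U. A = A ** B ** U"
proof -
  have "rank (transpose A) \<le> rank (transpose B ** transpose A)"
    using assms by (simp add: rank_transpose_field flip: matrix_transpose_mul)
  then obtain Y where "transpose A = Y ** (transpose B ** transpose A)"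
    using left_factor_of_rank_le by blast
  then have "A = A ** B ** transpose Y"
    by (metis matrix_transpose_mul transpose_transpose)
  then show ?thesis by blast
qed

text \<open>For a linear right inverse \<open>g\<close> of \<open>F\<close> on its range,
  \<open>g (F *v x)\<close> and \<open>x\<close> differ by a kernel vector of \<open>F\<close>,
  which \<open>G\<close> kills; hence \<open>G ** matrix g\<close> is a left factor.\<close>

lemma left_factor_of_kernel_subset:
  fixes F :: "'a::field ^ 'n ^ 'm" and G :: "'a ^ 'n ^ 'p"
  assumes "\<And>x. F *v x = 0 \<Longrightarrow> G *v x = 0"
  shows "\<exists>Y. G = Y ** F"
proof -
  obtain g where g: "Vector_Spaces.linear (*s) (*s) g" "\<And>x. F *v g (F *v x) = F *v x"
    using vec.linear_exists_right_inverse_on[OF matrix_vector_mul_linear_gen[of F] vec.subspace_UNIV]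
    by auto
  have "G *v x = (G ** matrix g ** F) *v x" for x
  proof -
    have "F *v (g (F *v x) - x) = 0"
      using g(2) by (simp add: matrix_vector_mult_diff_distrib)
    then have "G *v (g (F *v x) - x) = 0" by (rule assms)
    then show ?thesis
      by (simp add: matrix_vector_mult_diff_distrib matrix_works[OF g(1)]
          flip: matrix_vector_mul_assoc)
  qed
  then have "G = G ** matrix g ** F" by (simp add: matrix_eq)
  then show ?thesis by blast
qed

section \<open>The conjugate transpose\<close>

lemma conj_transpose_conj_transpose [simp]: "conj_transpose (conj_transpose Q) = Q"
  by (simp add: vec_eq_iff conj_transpose_def)

lemma conj_transpose_mult: "conj_transpose (A ** B) = conj_transpose B ** conj_transpose A"
  by (simp add: vec_eq_iff conj_transpose_def matrix_matrix_mult_def mult.commute)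

text \<open>Adjointness for the Hermitian form, in coordinates because the inner product on
  \<open>complex ^ 'n\<close> is real-valued.\<close>

lemma conj_transpose_adjoint:
  fixes Q :: "complex ^ 'n ^ 'm"
  shows "(\<Sum>j\<in>UNIV. cnj (x $ j) * (conj_transpose Q *v v) $ j) =
    (\<Sum>i\<in>UNIV. cnj ((Q *v x) $ i) * v $ i)"
  by (simp add: matrix_vector_mult_def conj_transpose_def sum_distrib_left sum_distrib_right
      algebra_simps, rule sum.swap)

text \<open>Pairing the hypothesis with \<open>x\<close> and moving one factor across by adjointness
  gives the squared norm of \<open>Q *v x\<close>.\<close>

lemma conj_transpose_mult_self_kernel:
  fixes Q :: "complex ^ 'n ^ 'm"
  assumes "(conj_transpose Q ** Q) *v x = 0"
  shows "Q *v x = 0"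
proof -
  have "(\<Sum>i\<in>UNIV. cnj ((Q *v x) $ i) * (Q *v x) $ i) = 0"
    using assms by (simp add: matrix_vector_mul_assoc flip: conj_transpose_adjoint)
  then have "complex_of_real (\<Sum>i\<in>UNIV. (cmod ((Q *v x) $ i))\<^sup>2) = 0"
    by (simp only: of_real_sum complex_norm_square mult.commute)
  then have "(\<Sum>i\<in>UNIV. (cmod ((Q *v x) $ i))\<^sup>2) = 0"
    using of_real_eq_0_iff by blast
  then show ?thesis by (simp add: sum_nonneg_eq_0_iff vec_eq_iff)
qed

lemma left_factor_conj_transpose_mult_self:
  fixes Q :: "complex ^ 'n ^ 'm"
  shows "\<exists>Y. Q = Y ** (conj_transpose Q ** Q)"
  by (rule left_factor_of_kernel_subset) (rule conj_transpose_mult_self_kernel)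

lemma rank_conj_transpose:
  fixes Q :: "complex ^ 'n ^ 'm"
  shows "rank (conj_transpose Q) = rank Q"
proof -
  \<comment> \<open>Arbitrary dimensions allow its use for both \<open>Q\<close> and
    \<open>conj_transpose Q\<close>, whose types are swapped.\<close>
  have le: "rank R \<le> rank (conj_transpose R)" for R :: "complex ^ 'p ^ 'q"
  proof -
    obtain Y where "R = Y ** (conj_transpose R ** R)"
      using left_factor_conj_transpose_mult_self by blast
    then have "rank R \<le> rank (conj_transpose R ** R)"
      by (metis rank_mult_le_right)
    also have "\<dots> \<le> rank (conj_transpose R)" by (rule rank_mult_le_left)
    finally show ?thesis .
  qed
  show ?thesis using le[of Q] le[of "conj_transpose Q"] by simp
qed

text \<open>If \<open>Q = Y Q\<^sup>* Q\<close> then \<open>E = Y Q\<^sup>*\<close> fixes \<open>Q\<close> and satisfies \<open>E E\<^sup>* = E\<^sup>*\<close>, so it is Hermitian and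
  \<open>E = E E\<^sup>* = E\<^sup>* E = Q Y\<^sup>* Y Q\<^sup>*\<close>.\<close>

lemma conj_transpose_generalized_inverse:
  fixes Q :: "complex ^ 'n ^ 'm"
  shows "\<exists>Z. Q ** Z ** conj_transpose Q ** Q = Q"
proof -
  obtain Y where Y: "Q = Y ** (conj_transpose Q ** Q)"
    using left_factor_conj_transpose_mult_self by blast
  define E where "E = Y ** conj_transpose Q"
  have EQ: "E ** Q = Q" using Y by (simp add: E_def matrix_mul_assoc)
  have E': "conj_transpose E = Q ** conj_transpose Y"
    by (simp add: E_def conj_transpose_mult)
  have EE: "E ** conj_transpose E = conj_transpose E"
    by (simp add: E' matrix_mul_assoc EQ)
  then have "conj_transpose E = E"
    by (metis conj_transpose_conj_transpose conj_transpose_mult)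
  then have "conj_transpose E ** E ** Q = Q"
    by (metis EQ matrix_mul_assoc)
  then have "Q ** (conj_transpose Y ** Y) ** conj_transpose Q ** Q = Q"
    unfolding E' by (simp add: E_def matrix_mul_assoc)
  then show ?thesis by blast
qed

section \<open>Existence of the inverse\<close>

text \<open>The identity matrix puts each generator in its own ideal, so equality of principal
  ideals amounts to mutual divisibility.\<close>

lemma right_ideal_eq_iff:
  "right_ideal M = right_ideal N \<longleftrightarrow> (\<exists>U V. M = N ** U \<and> N = M ** V)"
proof
  assume "right_ideal M = right_ideal N"
  moreover have "L \<in> right_ideal L" for L :: "complex ^ 'n ^ 'n"
    unfolding right_ideal_def using matrix_mul_rid[of L, symmetric] by blast
  ultimately have "M \<in> right_ideal N" "N \<in> right_ideal M" by blast+
  then show "\<exists>U V. M = N ** U \<and> N = M ** V" unfolding right_ideal_def by blast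
next
  assume "\<exists>U V. M = N ** U \<and> N = M ** V"
  then obtain U V where U: "M = N ** U" and V: "N = M ** V" by blast
  have "M ** W = N ** (U ** W)" "N ** W = M ** (V ** W)" for W
    using arg_cong[OF U, of "\<lambda>L. L ** W"] arg_cong[OF V, of "\<lambda>L. L ** W"]
    by (simp_all add: matrix_mul_assoc)
  then show "right_ideal M = right_ideal N" unfolding right_ideal_def by blast
qed

lemma left_ideal_eq_iff:
  "left_ideal M = left_ideal N \<longleftrightarrow> (\<exists>U V. M = U ** N \<and> N = V ** M)"
proof
  assume "left_ideal M = left_ideal N"
  moreover have "L \<in> left_ideal L" for L :: "complex ^ 'n ^ 'n"
    unfolding left_ideal_def using matrix_mul_lid[of L, symmetric] by blast
  ultimately have "M \<in> left_ideal N" "N \<in> left_ideal M" by blast+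
  then show "\<exists>U V. M = U ** N \<and> N = V ** M" unfolding left_ideal_def by blast
next
  assume "\<exists>U V. M = U ** N \<and> N = V ** M"
  then obtain U V where U: "M = U ** N" and V: "N = V ** M" by blast
  have "W ** M = (W ** U) ** N" "W ** N = (W ** V) ** M" for W
    using arg_cong[OF U, of "\<lambda>L. W ** L"] arg_cong[OF V, of "\<lambda>L. W ** L"]
    by (simp_all add: matrix_mul_assoc)
  then show "left_ideal M = left_ideal N" unfolding left_ideal_def by blast
qed

text \<open>The powers of \<open>C ** A\<close> enter only through \<open>MP\<close>, which puts the
  column space of \<open>M ** P\<close> inside that of \<open>Q\<close>.\<close>

lemma exists_inverse_iff_rank_eq:
  fixes M P Q N :: "complex ^ 'n ^ 'n"
  assumes MP: "M ** P = Q ** N"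
  shows "(\<exists>X. M ** X ** Q = Q \<and> right_ideal X = right_ideal P \<and>
      left_ideal X = left_ideal (conj_transpose Q)) \<longleftrightarrow>
    rank P = rank Q \<and> rank Q = rank (M ** P)"
proof
  assume "\<exists>X. M ** X ** Q = Q \<and> right_ideal X = right_ideal P \<and>
      left_ideal X = left_ideal (conj_transpose Q)"
  then obtain X U V U' V' where X: "M ** X ** Q = Q" "X = P ** U" "P = X ** V"
      "X = U' ** conj_transpose Q" "conj_transpose Q = V' ** X"
    unfolding right_ideal_eq_iff left_ideal_eq_iff by blast
  have "rank X = rank P" using X(2,3) by (metis rank_mult_le_left order_antisym)
  moreover have "rank X = rank (conj_transpose Q)"
    using X(4,5) by (metis rank_mult_le_right order_antisym)
  ultimately have PQ: "rank P = rank Q" by (simp add: rank_conj_transpose)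
  have "Q = (M ** P) ** (U ** Q)" using X(1,2) by (simp add: matrix_mul_assoc)
  then have "rank Q \<le> rank (M ** P)" by (metis rank_mult_le_left)
  moreover have "rank (M ** P) \<le> rank P" by (rule rank_mult_le_right)
  ultimately show "rank P = rank Q \<and> rank Q = rank (M ** P)" using PQ by simp
next
  assume r: "rank P = rank Q \<and> rank Q = rank (M ** P)"
  \<comment> \<open>Rewriting \<open>M ** P\<close> as a right multiple of \<open>Q\<close> brings
    the rank equality into the form needed to factor \<open>Q\<close>.\<close>
  then have "rank Q \<le> rank (Q ** N)" by (simp add: MP)
  then obtain U where U: "Q = M ** P ** U"
    using right_factor_of_rank_le MP by metis
  obtain Z where Z: "Q ** Z ** conj_transpose Q ** Q = Q"
    using conj_transpose_generalized_inverse by blast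
  define X where "X = P ** U ** Z ** conj_transpose Q"
  have "M ** X ** Q = (M ** P ** U) ** Z ** conj_transpose Q ** Q"
    by (simp add: X_def matrix_mul_assoc)
  then have MXQ: "M ** X ** Q = Q"
    by (simp only: Z flip: U)
  \<comment> \<open>\<open>Q = M ** X ** Q\<close> is a product through \<open>X\<close>.\<close>
  then have rX: "rank Q \<le> rank X"
    by (metis rank_mult_le_left rank_mult_le_right order_trans)
  have XP: "X = P ** (U ** Z ** conj_transpose Q)"
    by (simp add: X_def matrix_mul_assoc)
  have "rank P \<le> rank X" using r rX by simp
  then have "right_ideal X = right_ideal P"
    using right_factor_of_rank_le XP unfolding right_ideal_eq_iff by metis
  moreover have "rank (conj_transpose Q) \<le> rank X"
    using rX by (simp add: rank_conj_transpose)
  then have "left_ideal X = left_ideal (conj_transpose Q)"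
    using left_factor_of_rank_le X_def unfolding left_ideal_eq_iff by metis
  ultimately show "\<exists>X. M ** X ** Q = Q \<and> right_ideal X = right_ideal P \<and>
      left_ideal X = left_ideal (conj_transpose Q)"
    using MXQ by blast
qed

lemma mat_pow_commute: "mat_pow M k ** M = M ** mat_pow M k"
  by (induction k) (simp_all add: matrix_mul_assoc[symmetric])

theorem theorem4p1:
  fixes A B C :: "complex ^ 'n ^ 'n" and k :: nat
  shows "core_EP_invertible B C A \<and> k \<in> core_EP_indices B C A \<longleftrightarrow>
    rank (mat_pow (C ** A) k ** B) = rank (mat_pow (C ** A) k ** C) \<and>
    rank (mat_pow (C ** A) k ** C) = rank (mat_pow (C ** A) (k + 1) ** B)"
proof -
  let ?M = "C ** A"
  let ?P = "mat_pow ?M k ** B" and ?Q = "mat_pow ?M k ** C"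
  \<comment> \<open>Moving the extra factor \<open>C ** A\<close> to the right of the power places
    its \<open>C\<close> where \<open>?Q\<close> ends, leaving \<open>A ** B\<close>.\<close>
  have "?M ** ?P = mat_pow ?M k ** ?M ** B"
    unfolding mat_pow_commute by (simp only: matrix_mul_assoc)
  then have "?M ** ?P = ?Q ** (A ** B)"
    by (simp add: matrix_mul_assoc)
  from exists_inverse_iff_rank_eq[OF this]
  show ?thesis
    by (auto simp: core_EP_invertible_def core_EP_indices_def core_EP_inverse_at_def
        matrix_mul_assoc)
qed

end
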